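(* Let $G$ be any additive abelian group whose torsion subgroup is cyclic. Let $m$ be an even positive integer, let $n$ be a positive integer, and let $A_1,\ldots,A_m$ be subsets of $G$ with cardinality $n$. Suppose that all the elements of $A_m$ have (finite) odd order. Then the elements of each $A_i$ ($1\le i\le m$) can be listed in a suitable order $a_{i1},\ldots,a_{in}$, so that all the sums $\sum_{i=1}^m a_{ij}$ ($1\le j\le n$) are pairwise distinct.
   Context: The torsion subgroup of $G$ is the set of elements of finite order. *)

theory Defs
  imports "HOL-Algebra.Algebra"
begin

text \<open>
  Abelian groups are HOL-Algebra's \<open>comm_group\<close>, written multiplicatively, so a sum of group
  elements is a \<open>finprod\<close>. \<open>group.ord G x\<close> is \<open>0\<close> exactly when \<open>x\<close> has infinite order;
  in particular \<open>odd (group.ord G x)\<close> entails that the order is finite.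
\<close>

definition torsion_set :: "('a, 'b) monoid_scheme \<Rightarrow> 'a set" where
  "torsion_set G = {x \<in> carrier G. group.ord G x \<noteq> 0}"

definition torsion_subgroup :: "('a, 'b) monoid_scheme \<Rightarrow> ('a, 'b) monoid_scheme" where
  "torsion_subgroup G = G\<lparr>carrier := torsion_set G\<rparr>"

lemma (in group) torsion_set_iff:
  "x \<in> torsion_set G \<longleftrightarrow> x \<in> carrier G \<and> (\<exists>k::nat. k > 0 \<and> x [^] k = \<one>)"
proof (cases "x \<in> carrier G")
  case True
  then have "ord x \<noteq> 0 \<longleftrightarrow> (\<exists>k::nat. k \<noteq> 0 \<and> x [^] k = \<one>)"
    using ord_eq_0 by metis
  then show ?thesis
    using True by (simp only: torsion_set_def mem_Collect_eq neq0_conv simp_thms)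
qed (simp add: torsion_set_def)

lemma (in comm_group) subgroup_torsion_set: "subgroup (torsion_set G) G"
proof
  show "torsion_set G \<subseteq> carrier G"
    by (auto simp: torsion_set_def)
  show "\<one> \<in> torsion_set G"
    by (simp add: torsion_set_def)
  show "inv x \<in> torsion_set G" if "x \<in> torsion_set G" for x
    using that by (simp add: torsion_set_def)
  show "x \<otimes> y \<in> torsion_set G" if xy: "x \<in> torsion_set G" "y \<in> torsion_set G" for x y
  proof -
    from xy have c: "x \<in> carrier G" "y \<in> carrier G"
      by (simp_all add: torsion_set_def)
    from xy have pos: "ord x * ord y > 0"
      by (simp add: torsion_set_def)
    have "x [^] (ord x * ord y) = \<one>" "y [^] (ord x * ord y) = \<one>"
      using c by (simp_all add: pow_eq_id)
    then have "(x \<otimes> y) [^] (ord x * ord y) = \<one>"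
      using c by (simp add: nat_pow_distrib)
    with pos c show ?thesis
      unfolding torsion_set_iff by blast
  qed
qed

end

theory Submission
  imports Defs "Jordan_Normal_Form.Determinant" "HOL-Library.Real_Mod"
    "HOL-Analysis.Continuum_Not_Denumerable"
begin

text \<open>
  A finitely generated subgroup of \<open>G\<close> containing the cyclic torsion subgroup embeds into
  \<open>\<complex>\<^sup>*\<close>, so the \<open>A\<^sub>i\<close> may be taken to be sets of nonzero complex numbers. If every choice of
  permutations \<open>\<sigma>\<^sub>1, \<dots>, \<sigma>\<^bsub>m-1\<^esub>\<close> made two of the products coincide, all Vandermonde determinants
  of these products would vanish. Their sum weighted by \<open>sgn \<sigma>\<^sub>1 \<cdots> sgn \<sigma>\<^bsub>m-1\<^esub>\<close> is, for even
  \<open>m\<close>, the product of the Vandermonde determinants of \<open>A\<^sub>1, \<dots>, A\<^bsub>m-1\<^esub>\<close> and the permanent of the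
  Vandermonde matrix of \<open>A\<^sub>m\<close>. The permanent is congruent to the determinant modulo 2 in the ring
  generated by the roots of unity of odd order \<open>M\<close>, where the determinant divides a power of \<open>M\<close>
  and hence is not divisible by 2. So the permanent is nonzero, a contradiction.
\<close>

section \<open>Vandermonde determinants and permanents\<close>

definition vandermonde :: "nat \<Rightarrow> (nat \<Rightarrow> 'a::comm_ring_1) \<Rightarrow> 'a mat" where
  "vandermonde n a = mat n n (\<lambda>(j, k). a j ^ k)"

definition vandermonde_permanent :: "nat \<Rightarrow> (nat \<Rightarrow> 'a::comm_ring_1) \<Rightarrow> 'a" where
  "vandermonde_permanent n a = (\<Sum>p | p permutes {0..<n}. \<Prod>j=0..<n. a j ^ p j)"

lemma vandermonde_carrier [simp]: "vandermonde n a \<in> carrier_mat n n"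
  by (simp add: vandermonde_def)

lemma det_vandermonde:
  "det (vandermonde n a) = (\<Sum>p | p permutes {0..<n}. signof p * (\<Prod>j=0..<n. a j ^ p j))"
  unfolding det_def'[OF vandermonde_carrier]
  by (intro sum.cong refl arg_cong2[of _ _ _ _ "(*)"] prod.cong)
     (auto simp: vandermonde_def dest: permutes_in_image)

lemma det_vandermonde_eq_0:
  assumes "\<not> inj_on a {0..<n}"
  shows "det (vandermonde n a) = 0"
proof -
  from assms obtain i j where "i \<noteq> j" "i < n" "j < n" "a i = a j"
    by (auto simp: inj_on_def)
  then show ?thesis
    by (intro det_identical_rows[OF vandermonde_carrier, of i j])
       (auto simp: vandermonde_def intro!: eq_vecI)
qed

text \<open>Multiplying by the coefficients of the unnormalised Lagrange basis polynomials makes the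
  Vandermonde matrix diagonal. This replaces the closed form of the determinant.\<close>

definition lagrange_poly :: "nat \<Rightarrow> (nat \<Rightarrow> 'a::comm_ring_1) \<Rightarrow> nat \<Rightarrow> 'a poly" where
  "lagrange_poly n a j = (\<Prod>i\<in>{0..<n} - {j}. [:- a i, 1:])"

definition lagrange_mat :: "nat \<Rightarrow> (nat \<Rightarrow> 'a::comm_ring_1) \<Rightarrow> 'a mat" where
  "lagrange_mat n a = mat n n (\<lambda>(k, j). Polynomial.coeff (lagrange_poly n a j) k)"

lemma lagrange_mat_carrier [simp]: "lagrange_mat n a \<in> carrier_mat n n"
  by (simp add: lagrange_mat_def)

lemma degree_prod_linear_le:
  fixes a :: "'b \<Rightarrow> 'a::comm_ring_1"
  shows "finite I \<Longrightarrow> Polynomial.degree (\<Prod>i\<in>I. [:- a i, 1:]) \<le> card I"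
proof (induction I rule: finite_induct)
  case (insert x I)
  have "Polynomial.degree ([:- a x, 1:] * (\<Prod>i\<in>I. [:- a i, 1:]))
      \<le> Polynomial.degree [:- a x, 1:] + Polynomial.degree (\<Prod>i\<in>I. [:- a i, 1:])"
    by (rule degree_mult_le)
  also have "\<dots> \<le> 1 + card I"
    using insert.IH by (intro add_mono) simp_all
  finally show ?case
    using insert.hyps by simp
qed simp

lemma poly_eq_sum_lessThan:
  fixes p :: "'a::comm_ring_1 poly"
  assumes "Polynomial.degree p < n"
  shows "poly p x = (\<Sum>k=0..<n. Polynomial.coeff p k * x ^ k)"
proof -
  have "poly p x = (\<Sum>k\<le>Polynomial.degree p. Polynomial.coeff p k * x ^ k)"
    by (rule poly_altdef)
  also have "\<dots> = (\<Sum>k=0..<n. Polynomial.coeff p k * x ^ k)"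
    using assms by (intro sum.mono_neutral_left) (auto simp: coeff_eq_0)
  finally show ?thesis .
qed

text \<open>Row \<open>i\<close> times column \<open>j\<close> evaluates the polynomial
  \<open>lagrange_poly n a j\<close> at \<open>a i\<close>. For distinct \<open>i\<close> and
  \<open>j\<close> the factor with index \<open>i\<close> vanishes there.\<close>

lemma vandermonde_mult_lagrange:
  "vandermonde n a * lagrange_mat n a =
     mat n n (\<lambda>(i, j). if i = j then \<Prod>l\<in>{0..<n} - {j}. a j - a l else 0)"
proof (rule eq_matI)
  fix i j
  assume "i < dim_row (mat n n (\<lambda>(i, j). if i = j then \<Prod>l\<in>{0..<n} - {j}. a j - a l else 0))"
    and "j < dim_col (mat n n (\<lambda>(i, j). if i = j then \<Prod>l\<in>{0..<n} - {j}. a j - a l else 0))"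
  then have ij: "i < n" "j < n"
    by simp_all
  have deg: "Polynomial.degree (lagrange_poly n a j) < n"
    using degree_prod_linear_le[of "{0..<n} - {j}" a] ij by (simp add: lagrange_poly_def)
  have "(vandermonde n a * lagrange_mat n a) $$ (i, j) =
      (\<Sum>k=0..<n. Polynomial.coeff (lagrange_poly n a j) k * a i ^ k)"
    using ij by (auto simp: vandermonde_def lagrange_mat_def scalar_prod_def mult.commute intro!: sum.cong)
  also have "\<dots> = (\<Prod>l\<in>{0..<n} - {j}. a i - a l)"
    using poly_eq_sum_lessThan[OF deg, of "a i"] by (simp add: lagrange_poly_def poly_prod)
  also have "\<dots> = (if i = j then \<Prod>l\<in>{0..<n} - {j}. a j - a l else 0)"
    using ij by (auto intro!: prod_zero)
  finally show "(vandermonde n a * lagrange_mat n a) $$ (i, j) =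
      mat n n (\<lambda>(i, j). if i = j then \<Prod>l\<in>{0..<n} - {j}. a j - a l else 0) $$ (i, j)"
    using ij by simp
qed (simp_all add: vandermonde_def lagrange_mat_def)

text \<open>Serves two purposes: over an integral domain it shows that distinct nodes give a nonzero
  determinant, and over a ring containing the nodes it shows that the determinant divides the
  product of their differences.\<close>

lemma det_vandermonde_mult_det_lagrange:
  "det (vandermonde n a) * det (lagrange_mat n a) =
     (\<Prod>j=0..<n. \<Prod>l\<in>{0..<n} - {j}. a j - a l)"
proof -
  let ?D = "mat n n (\<lambda>(i, j). if i = j then \<Prod>l\<in>{0..<n} - {j}. a j - a l else 0)"
  have "det ?D = prod_list (diag_mat ?D)"
    by (intro det_upper_triangular[of _ n]) (auto simp: upper_triangular_def)
  also have "\<dots> = (\<Prod>j=0..<n. \<Prod>l\<in>{0..<n} - {j}. a j - a l)"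
    by (simp add: prod_list_diag_prod)
  finally show ?thesis
    by (simp flip: det_mult[OF vandermonde_carrier lagrange_mat_carrier]
             add: vandermonde_mult_lagrange)
qed

lemma det_vandermonde_nonzero:
  fixes a :: "nat \<Rightarrow> 'a::idom"
  assumes "inj_on a {0..<n}"
  shows "det (vandermonde n a) \<noteq> 0"
proof -
  have "(\<Prod>j=0..<n. \<Prod>l\<in>{0..<n} - {j}. a j - a l) \<noteq> 0"
    using assms by (auto simp: inj_on_def)
  then show ?thesis
    unfolding det_vandermonde_mult_det_lagrange[symmetric] by auto
qed

section \<open>Signed sums of Vandermonde determinants\<close>

text \<open>Expanding each determinant over permutations \<tau> and swapping the sums lets the sum
  over the families \<sigma> factor into one sum per \<open>s\<close>. Each factor is the
  Vandermonde determinant of \<open>c s\<close> times the sign of \<tau>. With the sign from the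
  expansion, \<tau> contributes its sign \<open>card I + 1\<close> times, an even number, so the
  signs cancel and the permanent of \<open>d\<close> remains.\<close>

lemma sum_signed_vandermonde:
  fixes c :: "'s \<Rightarrow> nat \<Rightarrow> 'a::comm_ring_1" and n :: nat
  assumes I: "finite I" "odd (card I)"
  defines "P \<equiv> {p. p permutes {0..<n}}"
  shows "(\<Sum>\<sigma>\<in>PiE I (\<lambda>_. P). (\<Prod>s\<in>I. signof (\<sigma> s)) *
            det (vandermonde n (\<lambda>j. d j * (\<Prod>s\<in>I. c s (\<sigma> s j))))) =
         (\<Prod>s\<in>I. det (vandermonde n (c s))) * vandermonde_permanent n d"
proof -
  have fin: "finite P"
    by (simp add: P_def finite_permutations)
  \<comment> \<open>This is the Leibniz expansion of the transposed Vandermonde matrix with its rows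
    permuted by \<tau>.\<close>
  have inner: "(\<Sum>p\<in>P. signof p * (\<Prod>j=0..<n. c s (p j) ^ \<tau> j)) =
      signof \<tau> * det (vandermonde n (c s))" if \<tau>: "\<tau> \<in> P" for s \<tau>
  proof -
    let ?V = "transpose_mat (vandermonde n (c s))"
    let ?N = "mat n n (\<lambda>(j, k). ?V $$ (\<tau> j, k))"
    have \<tau>': "\<tau> permutes {0..<n}"
      using \<tau> by (simp add: P_def)
    have "det ?N = (\<Sum>p\<in>P. signof p * (\<Prod>j=0..<n. ?N $$ (j, p j)))"
      by (simp add: det_def'[of _ n] P_def)
    also have "\<dots> = (\<Sum>p\<in>P. signof p * (\<Prod>j=0..<n. c s (p j) ^ \<tau> j))"
      using permutes_in_image[OF \<tau>']
      by (intro sum.cong refl arg_cong2[of _ _ _ _ "(*)"] prod.cong)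
         (auto simp: vandermonde_def P_def dest: permutes_in_image)
    finally show ?thesis
      using det_permute_rows[of ?V n \<tau>] \<tau>' by (simp add: det_transpose[of _ n])
  qed
  have "(\<Sum>\<sigma>\<in>PiE I (\<lambda>_. P). (\<Prod>s\<in>I. signof (\<sigma> s)) *
            det (vandermonde n (\<lambda>j. d j * (\<Prod>s\<in>I. c s (\<sigma> s j))))) =
     (\<Sum>\<sigma>\<in>PiE I (\<lambda>_. P). \<Sum>\<tau>\<in>P. signof \<tau> * (\<Prod>j=0..<n. d j ^ \<tau> j) *
        (\<Prod>s\<in>I. signof (\<sigma> s) * (\<Prod>j=0..<n. c s (\<sigma> s j) ^ \<tau> j)))"
    unfolding det_vandermonde P_def[symmetric] sum_distrib_left
  proof (intro sum.cong refl)
    fix \<sigma> \<tau>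
    have "(\<Prod>j=0..<n. (d j * (\<Prod>s\<in>I. c s (\<sigma> s j))) ^ \<tau> j) =
       (\<Prod>j=0..<n. d j ^ \<tau> j) * (\<Prod>s\<in>I. \<Prod>j=0..<n. c s (\<sigma> s j) ^ \<tau> j)"
      by (subst prod.swap) (simp add: power_mult_distrib prod.distrib prod_power_distrib)
    then show "(\<Prod>s\<in>I. signof (\<sigma> s)) *
        (signof \<tau> * (\<Prod>j=0..<n. (d j * (\<Prod>s\<in>I. c s (\<sigma> s j))) ^ \<tau> j)) =
      signof \<tau> * (\<Prod>j=0..<n. d j ^ \<tau> j) *
        (\<Prod>s\<in>I. signof (\<sigma> s) * (\<Prod>j=0..<n. c s (\<sigma> s j) ^ \<tau> j))"
      by (simp add: prod.distrib mult_ac)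
  qed
  also have "\<dots> = (\<Sum>\<tau>\<in>P. signof \<tau> * (\<Prod>j=0..<n. d j ^ \<tau> j) *
        (\<Sum>\<sigma>\<in>PiE I (\<lambda>_. P). \<Prod>s\<in>I. signof (\<sigma> s) * (\<Prod>j=0..<n. c s (\<sigma> s j) ^ \<tau> j)))"
    by (subst sum.swap) (simp add: sum_distrib_left)
  also have "\<dots> = (\<Sum>\<tau>\<in>P. signof \<tau> * (\<Prod>j=0..<n. d j ^ \<tau> j) *
        (\<Prod>s\<in>I. \<Sum>p\<in>P. signof p * (\<Prod>j=0..<n. c s (p j) ^ \<tau> j)))"
    using I fin by (subst prod_sum_PiE) simp_all
  also have "\<dots> = (\<Sum>\<tau>\<in>P. (signof \<tau> * signof \<tau> ^ card I) * (\<Prod>j=0..<n. d j ^ \<tau> j) *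
        (\<Prod>s\<in>I. det (vandermonde n (c s))))"
    by (intro sum.cong refl) (simp add: inner prod.distrib mult_ac)
  also have "\<dots> = (\<Sum>\<tau>\<in>P. (\<Prod>j=0..<n. d j ^ \<tau> j) * (\<Prod>s\<in>I. det (vandermonde n (c s))))"
  proof (intro sum.cong refl)
    fix \<tau>
    \<comment> \<open>The parity of \<open>card I\<close> enters here.\<close>
    have "signof \<tau> * signof \<tau> ^ card I = (1 :: 'a)"
      using I(2) by (auto simp: sign_def)
    then show "signof \<tau> * signof \<tau> ^ card I * (\<Prod>j=0..<n. d j ^ \<tau> j) *
        (\<Prod>s\<in>I. det (vandermonde n (c s))) =
      (\<Prod>j=0..<n. d j ^ \<tau> j) * (\<Prod>s\<in>I. det (vandermonde n (c s)))"
      by simp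
  qed
  finally show ?thesis
    by (simp add: vandermonde_permanent_def P_def sum_distrib_left mult.commute)
qed

text \<open>\<open>d\<close> is the one listing that stays fixed; \<open>I\<close> indexes the
  others. If every family of permutations produced a repetition, all determinants in the signed sum
  would vanish, although the sum is a product of nonzero factors.\<close>

theorem exists_permutations_inj_on_prod:
  fixes c :: "'s \<Rightarrow> nat \<Rightarrow> 'a::idom"
  assumes I: "finite I" "odd (card I)"
    and c: "\<And>s. s \<in> I \<Longrightarrow> inj_on (c s) {0..<n}"
    and d: "vandermonde_permanent n d \<noteq> 0"
  obtains \<sigma> where "\<And>s. s \<in> I \<Longrightarrow> \<sigma> s permutes {0..<n}"
    and "inj_on (\<lambda>j. d j * (\<Prod>s\<in>I. c s (\<sigma> s j))) {0..<n}"
proof -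
  have "\<exists>\<sigma>\<in>PiE I (\<lambda>_. {p. p permutes {0..<n}}). inj_on (\<lambda>j. d j * (\<Prod>s\<in>I. c s (\<sigma> s j))) {0..<n}"
  proof (rule ccontr)
    assume "\<not> ?thesis"
    then have "(\<Prod>s\<in>I. det (vandermonde n (c s))) * vandermonde_permanent n d = 0"
      unfolding sum_signed_vandermonde[OF I, symmetric]
      by (intro sum.neutral) (auto simp: det_vandermonde_eq_0)
    then show False
      using I c d det_vandermonde_nonzero by auto
  qed
  then show thesis
    using that by (auto simp: PiE_iff)
qed

section \<open>Permanents at roots of unity of odd order\<close>

text \<open>For positive \<open>M\<close> this is the ring of integer combinations of the
  \<open>M\<close>-th roots of unity. Generating it additively makes additive functionals on it easy
  to control; closure under products is proved separately.\<close>

inductive_set roots_ring :: "nat \<Rightarrow> complex set" for M :: nat where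
  zero: "0 \<in> roots_ring M"
| add_root: "x \<in> roots_ring M \<Longrightarrow> z ^ M = 1 \<Longrightarrow> x + z \<in> roots_ring M"
| diff_root: "x \<in> roots_ring M \<Longrightarrow> z ^ M = 1 \<Longrightarrow> x - z \<in> roots_ring M"

lemma roots_ring_root: "z ^ M = 1 \<Longrightarrow> z \<in> roots_ring M"
  using roots_ring.add_root[OF roots_ring.zero] by simp

lemma roots_ring_add:
  assumes "x \<in> roots_ring M" "y \<in> roots_ring M"
  shows "x + y \<in> roots_ring M"
  using assms(2,1)
  by (induction rule: roots_ring.induct)
     (auto simp: add.assoc[symmetric] add_diff_eq intro: roots_ring.intros)

lemma roots_ring_uminus:
  assumes "x \<in> roots_ring M"
  shows "- x \<in> roots_ring M"
  using assms
proof (induction rule: roots_ring.induct)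
  case (add_root x z)
  then show ?case
    using roots_ring.diff_root[of "- x" M z] by simp
next
  case (diff_root x z)
  then show ?case
    using roots_ring.add_root[of "- x" M z] by simp
qed (simp add: roots_ring.zero)

lemma roots_ring_mult_root:
  assumes "x \<in> roots_ring M" "z ^ M = 1"
  shows "x * z \<in> roots_ring M"
  using assms
  by (induction rule: roots_ring.induct)
     (auto simp: distrib_right left_diff_distrib power_mult_distrib intro: roots_ring.intros)

lemma roots_ring_mult:
  assumes "x \<in> roots_ring M" "y \<in> roots_ring M"
  shows "x * y \<in> roots_ring M"
  using assms(2)
proof (induction rule: roots_ring.induct)
  case (add_root y z)
  then show ?case
    using roots_ring_add[OF _ roots_ring_mult_root[OF assms(1)]] by (simp add: distrib_left)
next
  case (diff_root y z)
  then show ?case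
    using roots_ring_add[OF _ roots_ring_uminus[OF roots_ring_mult_root[OF assms(1)]]]
    by (simp add: right_diff_distrib)
qed (simp add: roots_ring.zero)

lemma roots_ring_one: "1 \<in> roots_ring M"
  by (simp add: roots_ring_root)

lemma roots_ring_diff: "x \<in> roots_ring M \<Longrightarrow> y \<in> roots_ring M \<Longrightarrow> x - y \<in> roots_ring M"
  using roots_ring_add[OF _ roots_ring_uminus] by fastforce

lemma roots_ring_sum: "(\<And>i. i \<in> I \<Longrightarrow> f i \<in> roots_ring M) \<Longrightarrow> sum f I \<in> roots_ring M"
  by (induction I rule: infinite_finite_induct) (auto intro: roots_ring.zero roots_ring_add)

lemma roots_ring_prod: "(\<And>i. i \<in> I \<Longrightarrow> f i \<in> roots_ring M) \<Longrightarrow> prod f I \<in> roots_ring M"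
  by (induction I rule: infinite_finite_induct) (auto intro: roots_ring_one roots_ring_mult)

lemma roots_ring_of_nat: "of_nat k \<in> roots_ring M"
  by (induction k) (auto intro: roots_ring.zero roots_ring_one roots_ring_add)

lemma roots_ring_signof: "signof p \<in> roots_ring M"
  by (auto simp: sign_def roots_ring_one intro: roots_ring_uminus)

lemma roots_ring_power: "x \<in> roots_ring M \<Longrightarrow> x ^ k \<in> roots_ring M"
  by (induction k) (auto intro: roots_ring_one roots_ring_mult)

lemma roots_ring_det:
  assumes "A \<in> carrier_mat n n" "\<And>i j. i < n \<Longrightarrow> j < n \<Longrightarrow> A $$ (i, j) \<in> roots_ring M"
  shows "det A \<in> roots_ring M"
  unfolding det_def'[OF assms(1)]
  by (intro roots_ring_sum roots_ring_mult roots_ring_prod roots_ring_signof assms(2))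
     (auto dest: permutes_in_image)

text \<open>Together with \<open>roots_ring_det\<close> this places
  \<open>det (lagrange_mat n a)\<close> in the ring, so that the determinant identity becomes a
  divisibility inside it.\<close>

lemma roots_ring_coeff_prod_linear:
  assumes "finite I" "\<And>i. i \<in> I \<Longrightarrow> a i \<in> roots_ring M"
  shows "Polynomial.coeff (\<Prod>i\<in>I. [:- a i, 1:]) k \<in> roots_ring M"
  using assms
proof (induction I arbitrary: k rule: finite_induct)
  case empty
  then show ?case
    by (auto simp: coeff_1 roots_ring.zero roots_ring_one)
next
  case (insert x I)
  then show ?case
    by (cases k) (auto intro!: roots_ring_add roots_ring_mult roots_ring_uminus roots_ring_diff)
qed

section \<open>Rational functionals and the exclusion of 1/2\<close>

interpretation Q_complex: vector_space "\<lambda>(q::rat) (z::complex). of_rat q * z"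
  by unfold_locales (simp_all add: algebra_simps of_rat_add of_rat_mult)

interpretation Q_Q: vector_space "(*) :: rat \<Rightarrow> rat \<Rightarrow> rat"
  by unfold_locales (simp_all add: algebra_simps)

interpretation Q_complex_Q: vector_space_pair "\<lambda>(q::rat) (z::complex). of_rat q * z" "(*) :: rat \<Rightarrow> rat \<Rightarrow> rat"
  by unfold_locales

lemma finite_rat_common_denominator:
  fixes F :: "rat set"
  assumes "finite F"
  obtains q :: nat where "q > 0" "\<And>x. x \<in> F \<Longrightarrow> of_nat q * x \<in> \<int>"
proof -
  have "\<exists>q>0. \<forall>x\<in>F. of_nat q * x \<in> \<int>"
    using assms
  proof (induction F rule: finite_induct)
    case (insert x F)
    then obtain q where q: "q > 0" "\<forall>x\<in>F. of_nat q * x \<in> \<int>"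
      by blast
    obtain a b where ab: "b > 0" "x = of_int a / of_int b"
      by (metis quotient_of_div quotient_of_denom_pos surj_pair)
    have "of_nat (q * nat b) * y \<in> \<int>" if "y \<in> insert x F" for y
    proof (cases "y = x")
      case True
      have "of_nat (q * nat b) * y = of_int (int q * a)"
        using ab True by simp
      then show ?thesis
        by (metis Ints_of_int)
    next
      case False
      have "of_nat (q * nat b) * y = of_nat (nat b) * (of_nat q * y)"
        by simp
      then show ?thesis
        using False q that by (metis Ints_mult Ints_of_nat insertE)
    qed
    moreover have "q * nat b > 0"
      using q ab by simp
    ultimately show ?case
      by blast
  qed auto
  then show thesis
    using that by blast
qed

text \<open>The additive group of \<open>roots_ring M\<close> is finitely generated, so a \<open>\<rat>\<close>-linear functional
  fixing \<open>1\<close> takes values of bounded denominator on it. Powers of \<open>1/2\<close> would violate the bound.\<close>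

lemma half_notin_roots_ring:
  assumes "M > 0"
  shows "1 / 2 \<notin> roots_ring M"
proof
  assume half: "1 / 2 \<in> roots_ring M"
  have "Q_complex.independent {1::complex}"
    by (simp add: Q_complex.dependent_single)
  from Q_complex_Q.linear_independent_extend[OF this, of "\<lambda>_. 1"]
  obtain \<phi> where \<phi>: "Vector_Spaces.linear (\<lambda>(q::rat) (z::complex). of_rat q * z) (*) \<phi>" "\<phi> 1 = 1"
    by auto
  interpret \<phi>: Vector_Spaces.linear "\<lambda>(q::rat) (z::complex). of_rat q * z" "(*)" \<phi>
    by (rule \<phi>(1))
  have "finite {z::complex. z ^ M = 1}"
    using assms by (intro finite_nth_roots) auto
  then obtain q where q: "q > 0" "\<And>x. x \<in> \<phi> ` {z. z ^ M = 1} \<Longrightarrow> of_nat q * x \<in> \<int>"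
    using finite_rat_common_denominator by (metis finite_imageI)
  have int: "of_nat q * \<phi> x \<in> \<int>" if "x \<in> roots_ring M" for x
    using that
    by (induction rule: roots_ring.induct)
       (auto simp: \<phi>.add \<phi>.diff \<phi>.zero distrib_left right_diff_distrib q intro!: Ints_add Ints_diff)
  \<comment> \<open>The exponent is the common denominator \<open>q\<close> itself:
    \<open>q / 2 ^ q\<close> would be a positive integer, contradicting
    \<open>q < 2 ^ q\<close>.\<close>
  have "\<phi> ((1 / 2) ^ q) = (1 / 2) ^ q"
    using \<phi>.scale[of "(1 / 2) ^ q" 1] \<phi>(2) by (simp add: of_rat_power of_rat_divide)
  then have "of_nat q * (1 / 2) ^ q \<in> (\<int> :: rat set)"
    using int[OF roots_ring_power[OF half, of q]] by simp
  then obtain k :: int where k: "of_nat q * (1 / 2) ^ q = (of_int k :: rat)"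
    by (auto elim: Ints_cases)
  then have "(of_int (int q) :: rat) = of_int (k * 2 ^ q)"
    by (simp add: field_simps)
  then have "int q = k * 2 ^ q"
    by (simp only: of_int_eq_iff)
  moreover from this q(1) have "k > 0"
    by (metis of_nat_0_less_iff zero_less_mult_pos2 zero_less_numeral zero_less_power)
  ultimately have "int q \<ge> 2 ^ q"
    by (smt (verit) mult_le_cancel_right1 zero_less_power)
  then show False
    by (metis of_nat_less_two_power not_less)
qed

section \<open>Divisibility and reduction modulo 2\<close>

text \<open>The powers of \<open>u = z / w\<close> sum to 0, so \<open>M\<close> is the sum of the
  terms \<open>1 - u ^ k\<close>, each a multiple of \<open>1 - u\<close>. This differs from
  \<open>w - z\<close> only by the unit \<open>w\<close>.\<close>

lemma root_of_unity_diff_dvd: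
  fixes w z :: complex
  assumes "M > 0" "w ^ M = 1" "z ^ M = 1" "w \<noteq> z"
  obtains g where "g \<in> roots_ring M" "(w - z) * g = of_nat M"
proof -
  define u where "u = z / w"
  have "w \<noteq> 0"
    using assms by (auto simp: power_0_left)
  have u: "u ^ M = 1" "u \<noteq> 1"
    using assms \<open>w \<noteq> 0\<close> by (auto simp: u_def power_divide)
  have "(\<Sum>k<M. u ^ k) = 0"
    using u by (simp add: geometric_sum)
  then have "of_nat M = (\<Sum>k<M. 1 - u ^ k)"
    by (simp add: sum_subtractf)
  also have "\<dots> = (1 - u) * (\<Sum>k<M. \<Sum>l<k. u ^ l)"
    by (simp add: one_diff_power_eq sum_distrib_left)
  also have "\<dots> = (w - z) * (w ^ (M - 1) * (\<Sum>k<M. \<Sum>l<k. u ^ l))"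
  proof -
    \<comment> \<open>The inverse of \<open>w\<close> is written as a power, so that it visibly
      stays in the ring.\<close>
    have "w * w ^ (M - 1) = 1"
      using assms by (metis power_eq_if not_gr_zero)
    then have "1 - u = (w - z) * w ^ (M - 1)"
      using \<open>w \<noteq> 0\<close> by (simp add: u_def field_simps)
    then show ?thesis
      by simp
  qed
  finally have "(w - z) * (w ^ (M - 1) * (\<Sum>k<M. \<Sum>l<k. u ^ l)) = of_nat M" ..
  moreover have "w ^ (M - 1) * (\<Sum>k<M. \<Sum>l<k. u ^ l) \<in> roots_ring M"
    using assms u by (intro roots_ring_mult roots_ring_sum roots_ring_power roots_ring_root)
  ultimately show thesis
    using that by blast
qed

lemma prod_dvd_roots_ring:
  assumes "finite I" "\<And>i. i \<in> I \<Longrightarrow> \<exists>g \<in> roots_ring M. \<exists>k. f i * g = of_nat M ^ k"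
  shows "\<exists>g \<in> roots_ring M. \<exists>k. prod f I * g = of_nat M ^ k"
  using assms
proof (induction I rule: finite_induct)
  case empty
  then show ?case
    by (intro bexI[of _ 1] exI[of _ 0]) (auto simp: roots_ring_one)
next
  case (insert x I)
  then obtain g h k l where "g \<in> roots_ring M" "prod f I * g = of_nat M ^ k"
    "h \<in> roots_ring M" "f x * h = of_nat M ^ l"
    by (metis insertCI)
  then show ?case
    using insert.hyps
    by (intro bexI[of _ "h * g"] exI[of _ "l + k"])
       (auto simp: power_add mult_ac roots_ring_mult dest!: sym[of _ "of_nat M ^ _"])
qed

text \<open>The two expansions differ only at odd permutations, where the terms have opposite signs;
  \<open>b\<close> collects these terms.\<close>

lemma permanent_cong_det:
  assumes "\<And>j. j < n \<Longrightarrow> a j \<in> roots_ring M"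
  obtains b where "b \<in> roots_ring M" "vandermonde_permanent n a = det (vandermonde n a) + 2 * b"
proof
  let ?P = "{p. p permutes {0..<n}}"
  let ?b = "\<Sum>p\<in>?P. (if evenperm p then 0 else \<Prod>j=0..<n. a j ^ p j)"
  show "?b \<in> roots_ring M"
    using assms by (intro roots_ring_sum) (auto intro!: roots_ring.zero roots_ring_prod roots_ring_power)
  show "vandermonde_permanent n a = det (vandermonde n a) + 2 * ?b"
    unfolding vandermonde_permanent_def det_vandermonde sum_distrib_left sum.distrib[symmetric]
    by (intro sum.cong) (auto simp: sign_def)
qed

theorem vandermonde_permanent_nonzero:
  fixes a :: "nat \<Rightarrow> complex"
  assumes inj: "inj_on a {0..<n}" and M: "odd M" and root: "\<And>j. j < n \<Longrightarrow> a j ^ M = 1"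
  shows "vandermonde_permanent n a \<noteq> 0"
proof
  assume zero: "vandermonde_permanent n a = 0"
  have a: "a j \<in> roots_ring M" if "j < n" for j
    using root[OF that] by (rule roots_ring_root)
  obtain b where b: "b \<in> roots_ring M" "vandermonde_permanent n a = det (vandermonde n a) + 2 * b"
    using permanent_cong_det a by metis
  have "\<exists>g\<in>roots_ring M. \<exists>k. (a j - a l) * g = of_nat M ^ k" if "j < n" "l < n" "l \<noteq> j" for j l
  proof -
    have "a j \<noteq> a l"
      using inj that by (auto simp: inj_on_def)
    then show ?thesis
      using root_of_unity_diff_dvd[of M "a j" "a l"] root that M by (metis power_one_right odd_pos)
  qed
  then have "\<exists>g\<in>roots_ring M. \<exists>k. (\<Prod>j=0..<n. \<Prod>l\<in>{0..<n} - {j}. a j - a l) * g = of_nat M ^ k"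
    by (intro prod_dvd_roots_ring) auto
  then obtain g k where g: "g \<in> roots_ring M"
      "det (vandermonde n a) * det (lagrange_mat n a) * g = of_nat M ^ k"
    unfolding det_vandermonde_mult_det_lagrange[symmetric] by blast
  \<comment> \<open>A vanishing permanent forces the determinant to be \<open>- 2 * b\<close>, so
    the odd number \<open>M ^ k\<close> becomes twice the ring element \<open>x\<close>. Subtracting
    an integer from \<open>x\<close> then leaves 1/2.\<close>
  define x where "x = - (b * det (lagrange_mat n a) * g)"
  have "det (lagrange_mat n a) \<in> roots_ring M"
    by (intro roots_ring_det[of _ n])
       (auto simp: lagrange_mat_def lagrange_poly_def intro!: roots_ring_coeff_prod_linear a)
  then have x: "x \<in> roots_ring M"
    using b g by (auto simp: x_def intro!: roots_ring_uminus roots_ring_mult)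
  have "det (vandermonde n a) = - 2 * b"
    using zero b by (simp add: eq_neg_iff_add_eq_0)
  then have eq: "2 * x = of_nat (M ^ k)"
    using g by (simp add: x_def mult_ac)
  have "odd (M ^ k)"
    using M by simp
  then obtain e where "M ^ k = 2 * e + 1"
    by (rule oddE)
  then have "2 * x = 2 * of_nat e + 1"
    using eq by simp
  then have "x - of_nat e = 1 / 2"
    by (simp add: field_simps)
  then have "1 / 2 \<in> roots_ring M"
    using roots_ring_diff[OF x roots_ring_of_nat] by metis
  then show False
    using half_notin_roots_ring M by (metis odd_pos)
qed

section \<open>Embedding into the multiplicative group of the complex numbers\<close>

context comm_group
begin

text \<open>The target is the multiplicative group of nonzero complex numbers. Constraining a total
  function on \<open>H\<close> avoids setting up a group structure on the target and lets the domain
  grow without a change of type.\<close>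

definition complex_embedding :: "'a set \<Rightarrow> ('a \<Rightarrow> complex) \<Rightarrow> bool" where
  "complex_embedding H \<phi> \<longleftrightarrow> subgroup H G \<and> inj_on \<phi> H \<and> (\<forall>x\<in>H. \<phi> x \<noteq> 0) \<and>
     (\<forall>x\<in>H. \<forall>y\<in>H. \<phi> (x \<otimes> y) = \<phi> x * \<phi> y)"

context
  fixes H \<phi>
  assumes emb: "complex_embedding H \<phi>"
begin

lemma emb_subgroup: "subgroup H G"
  and emb_inj: "inj_on \<phi> H"
  and emb_nonzero: "x \<in> H \<Longrightarrow> \<phi> x \<noteq> 0"
  and emb_mult: "x \<in> H \<Longrightarrow> y \<in> H \<Longrightarrow> \<phi> (x \<otimes> y) = \<phi> x * \<phi> y"
  using emb by (auto simp: complex_embedding_def)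

lemma emb_carrier: "x \<in> H \<Longrightarrow> x \<in> carrier G"
  using subgroup.subset[OF emb_subgroup] by blast

lemma emb_one: "\<phi> \<one> = 1"
  using emb_mult[of \<one> \<one>] emb_nonzero[of \<one>] subgroup.one_closed[OF emb_subgroup] by simp

lemma emb_eq_one_iff: "x \<in> H \<Longrightarrow> \<phi> x = 1 \<longleftrightarrow> x = \<one>"
  using emb_inj emb_one subgroup.one_closed[OF emb_subgroup] by (metis inj_on_eq_iff)

lemma emb_inv: "x \<in> H \<Longrightarrow> \<phi> (inv x) = inverse (\<phi> x)"
  using emb_mult[of x "inv x"] emb_one emb_carrier[of x] subgroup.m_inv_closed[OF emb_subgroup]
  by (metis inverse_unique r_inv)

lemma emb_nat_pow: "x \<in> H \<Longrightarrow> x [^] (k::nat) \<in> H \<and> \<phi> (x [^] k) = \<phi> x ^ k"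
  by (induction k) (auto simp: emb_one emb_mult subgroup.one_closed[OF emb_subgroup]
      subgroup.m_closed[OF emb_subgroup] mult.commute)

lemma emb_int_pow:
  assumes "x \<in> H"
  shows "x [^] (k::int) \<in> H \<and> \<phi> (x [^] k) = \<phi> x powi k"
proof (cases "k < 0")
  case True
  have "x [^] k = inv (x [^] nat (- k))"
    using True int_pow_def2[of G x k] by simp
  moreover have "\<phi> x powi k = inverse (\<phi> x ^ nat (- k))"
    using True by (simp add: power_int_def power_inverse)
  ultimately show ?thesis
    using emb_nat_pow[OF assms, of "nat (- k)"] emb_inv subgroup.m_inv_closed[OF emb_subgroup] by metis
next
  case False
  have "x [^] k = x [^] nat k"
    using False int_pow_def2[of G x k] by simp
  moreover have "\<phi> x powi k = \<phi> x ^ nat k"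
    using False by (simp add: power_int_def)
  ultimately show ?thesis
    using emb_nat_pow[OF assms, of "nat k"] by metis
qed

lemma emb_finprod:
  assumes "finite I" "\<And>i. i \<in> I \<Longrightarrow> f i \<in> H"
  shows "finprod G f I \<in> H \<and> \<phi> (finprod G f I) = (\<Prod>i\<in>I. \<phi> (f i))"
  using assms
proof (induction I rule: finite_induct)
  case empty
  then show ?case
    by (simp add: emb_one subgroup.one_closed[OF emb_subgroup])
next
  case (insert i I)
  then have "finprod G f (insert i I) = f i \<otimes> finprod G f I"
    by (intro finprod_insert) (auto intro: emb_carrier)
  then show ?case
    using insert by (auto simp: emb_mult intro: subgroup.m_closed[OF emb_subgroup])
qed

section \<open>Adjoining one element\<close>

text \<open>By \<open>key\<close>, sending \<open>(h, k)\<close> to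
  \<open>h \<otimes> x [^] k\<close> and to \<open>\<phi> h * z powi k\<close> gives two
  homomorphisms with the same kernel. Their images are therefore isomorphic, and this isomorphism is
  the new embedding.\<close>

lemma complex_embedding_adjoin:
  assumes x: "x \<in> carrier G" and z: "z \<noteq> 0"
    and key: "\<And>h k. h \<in> H \<Longrightarrow> h \<otimes> x [^] (k::int) = \<one> \<longleftrightarrow> \<phi> h * z powi k = 1"
  defines "H' \<equiv> (\<lambda>(h, k). h \<otimes> x [^] (k::int)) ` (H \<times> UNIV)"
  obtains \<phi>' where "complex_embedding H' \<phi>'" "insert x H \<subseteq> H'"
proof -
  note [simp] = x z emb_carrier emb_nonzero
  note sub = subgroup.one_closed[OF emb_subgroup] subgroup.m_closed[OF emb_subgroup]
    subgroup.m_inv_closed[OF emb_subgroup]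
  define \<psi> where "\<psi> h k = \<phi> h * z powi k" for h k
  have rearrange: "(h \<otimes> x [^] k) \<otimes> (h' \<otimes> x [^] k') = (h \<otimes> h') \<otimes> x [^] (k + k')"
    if "h \<in> H" "h' \<in> H" for h h' and k k' :: int
    using that by (simp add: int_pow_mult m_ac)
  have inverse: "inv (h \<otimes> x [^] k) = inv h \<otimes> x [^] (- k)" if "h \<in> H" for h and k :: int
    using that by (simp add: inv_mult int_pow_neg)
  \<comment> \<open>Applying \<open>key\<close> to the quotient gives well-definedness of the new
    map in one direction and its injectivity in the other.\<close>
  have eq_iff: "h \<otimes> x [^] k = h' \<otimes> x [^] k' \<longleftrightarrow> \<psi> h k = \<psi> h' k'"
    if "h \<in> H" "h' \<in> H" for h h' k k'
  proof -
    have "h \<otimes> x [^] k = h' \<otimes> x [^] k' \<longleftrightarrow> (h \<otimes> x [^] k) \<otimes> inv (h' \<otimes> x [^] k') = \<one>"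
      using that by (metis emb_carrier int_pow_closed inv_equality inv_inv m_closed r_inv x inv_closed)
    also have "\<dots> \<longleftrightarrow> (h \<otimes> inv h') \<otimes> x [^] (k + - k') = \<one>"
      using that sub by (simp only: inverse rearrange)
    also have "\<dots> \<longleftrightarrow> \<phi> (h \<otimes> inv h') * z powi (k + - k') = 1"
      using that by (intro key sub)
    also have "\<dots> \<longleftrightarrow> \<psi> h k = \<psi> h' k'"
      using that sub by (simp add: \<psi>_def emb_mult emb_inv power_int_diff field_simps)
    finally show ?thesis .
  qed
  define \<phi>' where "\<phi>' y = (SOME v. \<exists>h\<in>H. \<exists>k. y = h \<otimes> x [^] (k::int) \<and> v = \<psi> h k)" for y
  have \<phi>': "\<phi>' (h \<otimes> x [^] k) = \<psi> h k" if "h \<in> H" for h k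
    unfolding \<phi>'_def using that eq_iff by (intro some_equality) auto
  have "subgroup H' G"
  proof
    show "H' \<subseteq> carrier G"
      by (auto simp: H'_def)
    show "\<one> \<in> H'"
      using sub by (auto simp: H'_def image_iff intro!: bexI[of _ "\<one>"] exI[of _ 0])
    show "a \<otimes> b \<in> H'" if "a \<in> H'" "b \<in> H'" for a b
      using that sub by (fastforce simp: H'_def rearrange)
    show "inv a \<in> H'" if "a \<in> H'" for a
      using that sub by (fastforce simp: H'_def inverse)
  qed
  moreover have "inj_on \<phi>' H'"
    by (auto simp: inj_on_def H'_def \<phi>' eq_iff)
  moreover have "\<forall>y\<in>H'. \<phi>' y \<noteq> 0"
    by (auto simp: H'_def \<phi>' \<psi>_def)
  moreover have "\<forall>a\<in>H'. \<forall>b\<in>H'. \<phi>' (a \<otimes> b) = \<phi>' a * \<phi>' b"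
    using sub by (auto simp: H'_def rearrange \<phi>' \<psi>_def emb_mult power_int_add)
  ultimately have "complex_embedding H' \<phi>'"
    by (simp add: complex_embedding_def)
  moreover have "h \<in> H'" if "h \<in> H" for h
    using that by (auto simp: H'_def image_iff intro!: bexI[of _ h] exI[of _ 0])
  moreover have "x \<in> H'"
    using sub by (auto simp: H'_def image_iff intro!: bexI[of _ "\<one>"] exI[of _ 1])
  ultimately show thesis
    using that by blast
qed

end

text \<open>The exponents \<open>k\<close> with \<open>x [^] k\<close> in \<open>H\<close> form a
  subgroup of the integers, generated by its least positive element. The proof reduces
  \<open>k\<close> modulo \<open>d\<close>.\<close>

lemma int_pow_mem_iff_dvd:
  assumes H: "subgroup H G" and x: "x \<in> carrier G"
    and d: "d > 0" "x [^] d \<in> H" and min: "\<And>e::nat. 0 < e \<Longrightarrow> e < d \<Longrightarrow> x [^] e \<notin> H"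
  shows "x [^] (k::int) \<in> H \<longleftrightarrow> int d dvd k"
proof
  have pow: "x [^] (int d * q) \<in> H" for q
  proof -
    have "x [^] (int d * q) = (x [^] d) [^] q"
      using x by (simp add: int_pow_pow int_pow_int flip: int_pow_int)
    then show ?thesis
      using d subgroup_int_pow_closed[OF H] by metis
  qed
  {
    assume "int d dvd k"
    then show "x [^] k \<in> H"
      using pow by auto
  }
  assume k: "x [^] k \<in> H"
  have "x [^] (k mod int d) = x [^] k \<otimes> x [^] (int d * (- (k div int d)))"
    using x by (simp add: int_pow_mult[symmetric] minus_div_mult_eq_mod[symmetric] mult.commute)
  then have "x [^] (k mod int d) \<in> H"
    using k pow subgroup.m_closed[OF H] by metis
  then have "x [^] nat (k mod int d) \<in> H"
    using d by (simp flip: int_pow_int)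
  moreover have "nat (k mod int d) < d"
    using d by (simp add: nat_less_iff)
  ultimately have "k mod int d = 0"
    using min[of "nat (k mod int d)"] d by (metis not_gr_zero nat_0_iff pos_mod_sign of_nat_0_less_iff order_antisym)
  then show "int d dvd k"
    by auto
qed

text \<open>If some positive power of \<open>x\<close> lies in \<open>H\<close>, let \<open>d\<close> be the least such exponent. Any \<open>d\<close>-th root
  of \<open>\<phi> (x\<^sup>d)\<close> will do as the image of \<open>x\<close>: the kernel of the extension meets \<open>H\<close> trivially and is
  killed by \<open>d\<close>, so it consists of torsion elements, which lie in \<open>H\<close>. Otherwise \<open>x\<close> is sent outside
  a countable set of bad values.\<close>

lemma complex_embedding_step:
  assumes emb: "complex_embedding H \<phi>" and cnt: "countable H"
    and tors: "torsion_set G \<subseteq> H" and x: "x \<in> carrier G"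
  obtains H' \<phi>' where "complex_embedding H' \<phi>'" "countable H'" "insert x H \<subseteq> H'"
proof -
  note H = emb_subgroup[OF emb]
  have "\<exists>z. z \<noteq> 0 \<and> (\<forall>h\<in>H. \<forall>k::int. h \<otimes> x [^] k = \<one> \<longleftrightarrow> \<phi> h * z powi k = 1)"
  proof (cases "\<exists>d::nat. d > 0 \<and> x [^] d \<in> H")
    case True
    define d where "d = (LEAST d::nat. d > 0 \<and> x [^] d \<in> H)"
    have d: "d > 0" "x [^] d \<in> H"
      using LeastI_ex[OF True] by (simp_all add: d_def)
    have min: "x [^] e \<notin> H" if "0 < e" "e < d" for e :: nat
      using not_less_Least[of e] that unfolding d_def by blast
    note dvd = int_pow_mem_iff_dvd[OF H x d min]
    obtain z where z: "z ^ d = \<phi> (x [^] d)"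
      using card_nth_roots[OF emb_nonzero[OF emb d(2)] d(1)] d(1) by (metis (mono_tags, lifting) Collect_empty_eq card.empty less_irrefl)
    have "z \<noteq> 0"
      using z d emb_nonzero[OF emb d(2)] by (metis power_0_left neq0_conv)
    have agree: "\<phi> (x [^] k) = z powi k" if k: "int d dvd k" for k
    proof -
      obtain q where q: "k = int d * q"
        using k by blast
      have "x [^] k = (x [^] d) [^] q"
        using x by (simp add: q int_pow_pow flip: int_pow_int)
      then show ?thesis
        using emb_int_pow[OF emb d(2), of q] by (simp add: q power_int_mult flip: z)
    qed
    \<comment> \<open>If \<open>d\<close> divides \<open>k\<close>, then \<open>x [^] k\<close> lies
      in \<open>H\<close> and injectivity of \<phi> decides. Otherwise both sides are false.\<close>
    have "h \<otimes> x [^] k = \<one> \<longleftrightarrow> \<phi> h * z powi k = 1" if h: "h \<in> H" for h and k :: int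
    proof (cases "int d dvd k")
      case True
      then show ?thesis
        using dvd agree h emb_eq_one_iff[OF emb] emb_mult[OF emb] subgroup.m_closed[OF H] by metis
    next
      case False
      then have notin: "x [^] k \<notin> H"
        using dvd by blast
      have hc: "h \<in> carrier G"
        using h by (rule emb_carrier[OF emb])
      have y_notin: "h \<otimes> x [^] k \<notin> H"
      proof
        assume "h \<otimes> x [^] k \<in> H"
        then have "inv h \<otimes> (h \<otimes> x [^] k) \<in> H"
          using h subgroup.m_closed[OF H] subgroup.m_inv_closed[OF H] by metis
        then show False
          using notin hc x by (simp add: m_assoc[symmetric])
      qed
      have "\<phi> h * z powi k \<noteq> 1"
      proof
        assume one: "\<phi> h * z powi k = 1"
        have eq: "(h \<otimes> x [^] k) [^] d = h [^] d \<otimes> x [^] (int d * k)"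
          using hc x by (simp add: int_pow_distrib int_pow_pow mult.commute flip: int_pow_int)
        have mem: "h [^] d \<in> H" "x [^] (int d * k) \<in> H"
          using emb_nat_pow[OF emb h] dvd by auto
        have "\<phi> ((h \<otimes> x [^] k) [^] d) = \<phi> h ^ d * z powi (int d * k)"
          unfolding eq emb_mult[OF emb mem] using emb_nat_pow[OF emb h, of d] agree[of "int d * k"] by simp
        also have "\<dots> = (\<phi> h * z powi k) ^ d"
          by (simp add: power_int_mult_distrib power_int_mult mult.commute flip: power_int_of_nat)
        finally have "(h \<otimes> x [^] k) [^] d = \<one>"
          using one emb_eq_one_iff[OF emb] mem subgroup.m_closed[OF H] eq by simp
        then have "h \<otimes> x [^] k \<in> torsion_set G"
          using hc x d by (auto simp: torsion_set_iff)
        then show False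
          using tors y_notin by blast
      qed
      then show ?thesis
        using y_notin subgroup.one_closed[OF H] by metis
    qed
    then show ?thesis
      using \<open>z \<noteq> 0\<close> by blast
  next
    case False
    \<comment> \<open>The bad values are 0 and all roots of values of \<phi> on \<open>H\<close>.
      Countability of \<open>H\<close> is what leaves some complex number over.\<close>
    define B where "B = insert 0 (\<Union>k\<in>{0::nat<..}. \<Union>h\<in>H. {z. z ^ k = \<phi> h})"
    have "countable {z::complex. z ^ k = \<phi> h}" if "k \<in> {0<..}" for k :: nat and h
      using that by (intro countable_finite finite_nth_roots) auto
    then have "countable B"
      unfolding B_def using cnt by (intro countable_insert countable_UN) auto
    then obtain z where z: "z \<notin> B"
      using uncountable_UNIV_complex by (metis UNIV_I countable_subset subsetI)
    then have generic: "z ^ k \<noteq> \<phi> h" if "k > 0" "h \<in> H" for k h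
      using that by (auto simp: B_def)
    have z0: "z \<noteq> 0"
      using z by (simp add: B_def)
    \<comment> \<open>Either equation would make a nonzero power of \<open>x\<close> lie in
      \<open>H\<close> or a nonzero power of \<open>z\<close> a value of \<phi>. Hence only
      \<open>k = 0\<close> remains, where injectivity of \<phi> suffices.\<close>
    have k0: "k = 0" if h: "h \<in> H" and eq: "h \<otimes> x [^] k = \<one> \<or> \<phi> h * z powi k = 1" for h and k :: int
    proof (rule ccontr)
      assume "k \<noteq> 0"
      have hc: "h \<in> carrier G"
        using h by (rule emb_carrier[OF emb])
      have no_pow: "x [^] k \<notin> H" if "k \<noteq> 0" for k :: int
      proof
        assume "x [^] k \<in> H"
        then have "x [^] nat \<bar>k\<bar> \<in> H"
          using subgroup.m_inv_closed[OF H] x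
          by (cases "k \<ge> 0") (auto simp: int_pow_neg simp flip: int_pow_int)
        then show False
          using False that by (metis zero_less_abs_iff zero_less_nat_eq)
      qed
      from eq show False
      proof
        assume "h \<otimes> x [^] k = \<one>"
        then have "x [^] k = inv h"
          using hc x by (metis inv_equality int_pow_closed m_comm)
        then show False
          using no_pow \<open>k \<noteq> 0\<close> h subgroup.m_inv_closed[OF H] by metis
      next
        assume "\<phi> h * z powi k = 1"
        then have "z powi k = inverse (\<phi> h)"
          by (metis inverse_unique)
        then have "z powi k = \<phi> (inv h)" "z powi (- k) = \<phi> h"
          by (simp_all add: emb_inv[OF emb h] power_int_minus)
        \<comment> \<open>The first alternative covers nonnegative \<open>k\<close>, the second
          negative \<open>k\<close>.\<close>
        then have "z ^ nat \<bar>k\<bar> = \<phi> (inv h) \<or> z ^ nat \<bar>k\<bar> = \<phi> h"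
          by (cases "k \<ge> 0") (auto simp: power_int_def)
        then show False
          using generic[of "nat \<bar>k\<bar>"] \<open>k \<noteq> 0\<close> h subgroup.m_inv_closed[OF H h] by auto
      qed
    qed
    have "h \<otimes> x [^] k = \<one> \<longleftrightarrow> \<phi> h * z powi k = 1" if h: "h \<in> H" for h and k :: int
    proof (cases "k = 0")
      case True
      then show ?thesis
        using h emb_carrier[OF emb h] emb_eq_one_iff[OF emb h] by simp
    next
      case False
      then show ?thesis
        using k0[OF h] by blast
    qed
    then show ?thesis
      using z0 by blast
  qed
  then obtain z where z: "z \<noteq> 0"
      "\<And>h k. h \<in> H \<Longrightarrow> h \<otimes> x [^] (k::int) = \<one> \<longleftrightarrow> \<phi> h * z powi k = 1"
    by blast
  let ?H' = "(\<lambda>(h, k). h \<otimes> x [^] (k::int)) ` (H \<times> UNIV)"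
  obtain \<phi>' where "complex_embedding ?H' \<phi>'" "insert x H \<subseteq> ?H'"
    by (rule complex_embedding_adjoin[OF emb x z])
  moreover have "countable ?H'"
    using cnt by (intro countable_image countable_SIGMA) auto
  ultimately show thesis
    using that by blast
qed

section \<open>The torsion subgroup and finite extensions of it\<close>

text \<open>A generator of the torsion subgroup is itself torsion, hence of finite order
  \<open>N\<close>, and is sent to a primitive \<open>N\<close>-th root of unity.\<close>

lemma complex_embedding_torsion:
  assumes "cyclic_group (torsion_subgroup G)"
  obtains \<phi> where "complex_embedding (torsion_set G) \<phi>" "countable (torsion_set G)"
proof -
  let ?T = "torsion_set G"
  note T = subgroup_torsion_set
  interpret T: group "torsion_subgroup G"
    unfolding torsion_subgroup_def using T by (rule subgroup_imp_group)
  have carrier_T: "carrier (torsion_subgroup G) = ?T"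
    by (simp add: torsion_subgroup_def)
  obtain g where g: "g \<in> ?T" "?T = range (\<lambda>k::int. g [^]\<^bsub>torsion_subgroup G\<^esub> k)"
    using assms unfolding T.cyclic_group carrier_T by blast
  have "g [^]\<^bsub>torsion_subgroup G\<^esub> k = g [^] k" for k :: int
    unfolding torsion_subgroup_def using int_pow_consistent[OF T g(1)] by simp
  then have range: "?T = range (\<lambda>k::int. g [^] k)"
    using g(2) by simp
  have gc: "g \<in> carrier G"
    using g(1) by (simp add: torsion_set_def)
  define N where "N = ord g"
  have "N > 0"
    using g(1) by (simp add: torsion_set_def N_def)
  define \<zeta> where "\<zeta> = cis (2 * pi / N)"
  have [simp]: "\<zeta> \<noteq> 0"
    by (simp add: \<zeta>_def)
  have \<zeta>: "\<zeta> powi k = 1 \<longleftrightarrow> int N dvd k" for k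
  proof -
    have "\<zeta> powi k = 1 \<longleftrightarrow> (\<exists>q::int. of_int k * (2 * pi / N) = of_int q * (2 * pi))"
      by (simp add: \<zeta>_def cis_power_int cis_eq_1_iff)
    also have "\<dots> \<longleftrightarrow> (\<exists>q::int. real_of_int k = real_of_int (int N * q))"
      using \<open>N > 0\<close> by (simp add: field_simps)
    also have "\<dots> \<longleftrightarrow> int N dvd k"
      by (simp only: of_int_eq_iff dvd_def)
    finally show ?thesis .
  qed
  have eq_iff: "g [^] k = g [^] l \<longleftrightarrow> \<zeta> powi k = \<zeta> powi l" for k l :: int
  proof -
    have "g [^] k = g [^] l \<longleftrightarrow> g [^] (k - l) = \<one>"
      using gc by (metis int_pow_closed int_pow_diff inv_closed inv_equality inv_inv r_inv)
    also have "\<dots> \<longleftrightarrow> \<zeta> powi (k - l) = 1"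
      using gc by (simp add: int_pow_eq_id \<zeta> N_def)
    also have "\<dots> \<longleftrightarrow> \<zeta> powi k = \<zeta> powi l"
      by (simp add: power_int_diff field_simps)
    finally show ?thesis .
  qed
  define \<phi> where "\<phi> y = \<zeta> powi (SOME k. y = g [^] k)" for y
  have \<phi>: "\<phi> (g [^] k) = \<zeta> powi k" for k :: int
    unfolding \<phi>_def using someI[of "\<lambda>l. g [^] k = g [^] l" k] eq_iff by metis
  have "inj_on \<phi> ?T" "\<forall>x\<in>?T. \<phi> x \<noteq> 0"
    unfolding range by (auto simp: inj_on_def \<phi> eq_iff)
  moreover have "\<phi> (g [^] k \<otimes> g [^] l) = \<zeta> powi k * \<zeta> powi l" for k l :: int
    using gc \<phi>[of "k + l"] by (simp add: int_pow_mult power_int_add)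
  then have "\<forall>x\<in>?T. \<forall>y\<in>?T. \<phi> (x \<otimes> y) = \<phi> x * \<phi> y"
    unfolding range by (auto simp: \<phi>)
  ultimately have "complex_embedding ?T \<phi>"
    using T by (simp add: complex_embedding_def)
  moreover have "countable ?T"
    unfolding range by simp
  ultimately show thesis
    by (rule that)
qed

text \<open>Starting from the torsion subgroup, the elements of \<open>S\<close> are adjoined one at
  a time. The induction also carries countability and containment of the torsion, which each step
  requires.\<close>

theorem exists_complex_embedding:
  assumes "cyclic_group (torsion_subgroup G)" "finite S" "S \<subseteq> carrier G"
  obtains H \<phi> where "complex_embedding H \<phi>" "S \<subseteq> H"
proof -
  from assms(2,3) have "\<exists>H \<phi>. complex_embedding H \<phi> \<and> countable H \<and> torsion_set G \<union> S \<subseteq> H"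
  proof (induction S rule: finite_induct)
    case empty
    then show ?case
      using complex_embedding_torsion[OF assms(1)] by (metis Un_empty_right order_refl)
  next
    case (insert x S)
    then obtain H \<phi> where "complex_embedding H \<phi>" "countable H" "torsion_set G \<union> S \<subseteq> H"
      by auto
    moreover from this obtain H' \<phi>' where "complex_embedding H' \<phi>'" "countable H'" "insert x H \<subseteq> H'"
      using complex_embedding_step[of H \<phi> x] insert.prems by auto
    ultimately show ?case
      by (intro exI[of _ H'] exI[of _ \<phi>']) auto
  qed
  then show thesis
    using that by blast
qed

end

section \<open>Listing the sets\<close>

theorem corollary1p2:
  fixes G :: "('a, 'b) monoid_scheme"
    and m n :: nat
    and A :: "nat \<Rightarrow> 'a set"
  assumes "comm_group G"
    and "cyclic_group (torsion_subgroup G)"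
    and "even m" and "m > 0"
    and "n > 0"
    and "\<And>i. i \<in> {1..m} \<Longrightarrow> A i \<subseteq> carrier G \<and> card (A i) = n"
    and "\<And>x. x \<in> A m \<Longrightarrow> odd (group.ord G x)"
  shows "\<exists>a :: nat \<Rightarrow> nat \<Rightarrow> 'a.
           (\<forall>i\<in>{1..m}. bij_betw (a i) {1..n} (A i)) \<and>
           inj_on (\<lambda>j. finprod G (\<lambda>i. a i j) {1..m}) {1..n}"
proof -
  interpret comm_group G
    by fact
  \<comment> \<open>The \<open>m - 1\<close> sets to be permuted, an odd number; \<open>A m\<close>
    supplies the permanent.\<close>
  let ?I = "{1..<m}"
  have m: "{1..m} = insert m ?I" "m \<in> {1..m}"
    using \<open>m > 0\<close> by auto
  \<comment> \<open>Infinite sets have \<open>card\<close> 0, so \<open>n > 0\<close> yields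
    finiteness.\<close>
  have A: "A i \<subseteq> carrier G" "card (A i) = n" "finite (A i)" if "i \<in> {1..m}" for i
    using assms(6)[OF that] \<open>n > 0\<close> by (auto intro: card_ge_0_finite)
  have "finite (\<Union>i\<in>{1..m}. A i)"
    by (intro finite_UN_I A(3)) auto
  moreover have "(\<Union>i\<in>{1..m}. A i) \<subseteq> carrier G"
    by (intro UN_least A(1))
  ultimately obtain H \<phi> where emb: "complex_embedding H \<phi>" and AH: "(\<Union>i\<in>{1..m}. A i) \<subseteq> H"
    by (rule exists_complex_embedding[OF assms(2)])
  have "\<forall>i\<in>{1..m}. \<exists>e. bij_betw e {0..<n} (A i)"
    using A ex_bij_betw_nat_finite by metis
  then obtain e :: "nat \<Rightarrow> nat \<Rightarrow> 'a" where e: "\<And>i. i \<in> {1..m} \<Longrightarrow> bij_betw (e i) {0..<n} (A i)"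
    by metis
  have e_mem: "e i j \<in> A i" "e i j \<in> H" if "i \<in> {1..m}" "j < n" for i j
  proof -
    show "e i j \<in> A i"
      using bij_betwE[OF e[OF that(1)]] that(2) by simp
    then show "e i j \<in> H"
      using that(1) AH by blast
  qed
  have inj: "inj_on (\<lambda>j. \<phi> (e i j)) {0..<n}" if i: "i \<in> {1..m}" for i
  proof -
    have "inj_on \<phi> (e i ` {0..<n})"
      using emb_inj[OF emb] by (rule inj_on_subset) (use e_mem i in auto)
    then show ?thesis
      using comp_inj_on[OF bij_betw_imp_inj_on[OF e[OF i]]] by (simp add: comp_def)
  qed
  have perm: "vandermonde_permanent n (\<lambda>j. \<phi> (e m j)) \<noteq> 0"
  proof (rule vandermonde_permanent_nonzero)
    show "inj_on (\<lambda>j. \<phi> (e m j)) {0..<n}"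
      by (rule inj) (rule m)
    \<comment> \<open>The product of the orders is a common odd exponent for
      \<open>A m\<close>.\<close>
    show "odd (\<Prod>x\<in>A m. ord x)"
      using assms(7) A(3)[OF m(2)] by (simp add: even_prod_iff)
    show "\<phi> (e m j) ^ (\<Prod>x\<in>A m. ord x) = 1" if "j < n" for j
    proof -
      have x: "e m j \<in> A m" "e m j \<in> H"
        using e_mem[OF m(2) that] by blast+
      then have "ord (e m j) dvd (\<Prod>x\<in>A m. ord x)"
        using A(3)[OF m(2)] by (intro dvd_prodI) auto
      then have "e m j [^]\<^bsub>G\<^esub> (\<Prod>x\<in>A m. ord x) = \<one>\<^bsub>G\<^esub>"
        using pow_eq_id emb_carrier[OF emb x(2)] by blast
      then show ?thesis
        using emb_nat_pow[OF emb x(2)] emb_one[OF emb] by metis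
    qed
  qed
  obtain \<sigma> where \<sigma>: "\<And>s. s \<in> ?I \<Longrightarrow> \<sigma> s permutes {0..<n}"
    and inj_prod: "inj_on (\<lambda>j. \<phi> (e m j) * (\<Prod>s\<in>?I. \<phi> (e s (\<sigma> s j)))) {0..<n}"
  proof (rule exists_permutations_inj_on_prod)
    show "finite ?I" "odd (card ?I)"
      using \<open>even m\<close> \<open>m > 0\<close> by auto
    show "inj_on (\<lambda>j. \<phi> (e s j)) {0..<n}" if "s \<in> ?I" for s
      using that by (intro inj) auto
  qed (use perm in auto)
  \<comment> \<open>The index range shifts from \<open>{0..<n}\<close> to \<open>{1..n}\<close>.
    \<open>A m\<close> keeps its initial listing, and every other set is rearranged by its
    permutation.\<close>
  define a where "a i j = e i (if i = m then j - 1 else \<sigma> i (j - 1))" for i j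
  have shift: "bij_betw (\<lambda>j. j - 1) {1..n} {0..<n}"
    by (rule bij_betw_byWitness[of _ Suc]) auto
  have bij: "bij_betw (a i) {1..n} (A i)" if i: "i \<in> {1..m}" for i
  proof (cases "i = m")
    case True
    then show ?thesis
      using bij_betw_trans[OF shift e[OF i]] by (simp add: a_def[abs_def] comp_def)
  next
    case False
    then have "bij_betw (\<sigma> i) {0..<n} {0..<n}"
      using i by (intro permutes_imp_bij \<sigma>) auto
    then show ?thesis
      using bij_betw_trans[OF bij_betw_trans[OF shift] e[OF i]] False by (simp add: a_def[abs_def] comp_def)
  qed
  have eq: "\<phi> (finprod G (\<lambda>i. a i j) {1..m}) =
      \<phi> (e m (j - 1)) * (\<Prod>s\<in>?I. \<phi> (e s (\<sigma> s (j - 1))))" if "j \<in> {1..n}" for j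
  proof -
    have "a i j \<in> H" if "i \<in> {1..m}" for i
      using bij_betwE[OF bij[OF that]] \<open>j \<in> {1..n}\<close> that AH by blast
    then have "\<phi> (finprod G (\<lambda>i. a i j) {1..m}) = (\<Prod>i\<in>{1..m}. \<phi> (a i j))"
      using emb_finprod[OF emb, of "{1..m}" "\<lambda>i. a i j"] by blast
    also have "\<dots> = \<phi> (a m j) * (\<Prod>i\<in>?I. \<phi> (a i j))"
      unfolding m(1) by simp
    also have "(\<Prod>i\<in>?I. \<phi> (a i j)) = (\<Prod>s\<in>?I. \<phi> (e s (\<sigma> s (j - 1))))"
      by (intro prod.cong) (auto simp: a_def)
    finally show ?thesis
      by (simp add: a_def)
  qed
  have "inj_on (\<lambda>j. \<phi> (e m (j - 1)) * (\<Prod>s\<in>?I. \<phi> (e s (\<sigma> s (j - 1))))) {1..n}"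
    using comp_inj_on[OF bij_betw_imp_inj_on[OF shift]] inj_prod bij_betw_imp_surj_on[OF shift]
    by (simp add: comp_def)
  then have "inj_on (\<lambda>j. \<phi> (finprod G (\<lambda>i. a i j) {1..m})) {1..n}"
    by (subst inj_on_cong[OF eq])
  \<comment> \<open>Distinct images under \<phi> force distinct sums.\<close>
  then have "inj_on (\<lambda>j. finprod G (\<lambda>i. a i j) {1..m}) {1..n}"
    by (intro inj_on_imageI2[of \<phi>]) (simp only: comp_def)
  then show ?thesis
    using bij by (intro exI[of _ a]) simp
qed

end
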